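(* Let $\Gamma$ be a finite simple connected graph with vertex set $V$, $n=|V|$, diameter $D\ge 1$, adjacency matrix $A$ and largest eigenvalue $\lambda_0$. Let $H_{\le D-1}^*$ be the harmonic mean of the numbers $\frac{1}{\alpha_u^2}\|\rho_{N_{D-1}(u)}\|^2$ for $u\in V$, that is, $H_{\le D-1}^*=n\Big/\sum_{u\in V}\frac{\alpha_u^2}{\|\rho_{N_{D-1}(u)}\|^2}$, and let $\delta_D^*=\frac1n\sum_{u\in V}\alpha_u^2\|\rho_{\Gamma_D(u)}\|^2$ be the arithmetic mean of the numbers $\alpha_u^2\|\rho_{\Gamma_D(u)}\|^2$ for $u\in V$. Then $$p_{\ge D}(\lambda_0)\ \overset{(i)}{\ge}\ n-H_{\le D-1}^*\ \overset{(ii)}{\ge}\ \delta_D^*.$$ Moreover, equality in $(i)$ holds if and only if $$p_{\ge D}(A)=A_D^*,$$ whereas equality in $(ii)$ occurs when the numbers $\|\rho_{\Gamma_D(u)}\|^2$ are the same for all $u\in V$.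
   Context: Let $\Gamma$ be a finite simple connected graph with vertex set $V$, $n=|V|$, diameter $D$, adjacency matrix $A$, and distinct eigenvalues $\lambda_0>\lambda_1>\cdots>\lambda_d$ with multiplicities $m(\lambda_i)$. Perron vector: $\alpha=(\alpha_u)_{u\in V}$ is the eigenvector of $A$ for $\lambda_0$ with all entries positive, normalized so that $\|\alpha\|^2=\sum_u\alpha_u^2=n$ (Euclidean norm). For a vertex $u$, let $e_u$ be the corresponding coordinate vector, $\Gamma_i(u)$ the set of vertices at distance exactly $i$ from $u$ (possibly empty), and $N_j(u)=\Gamma_0(u)\cup\cdots\cup\Gamma_j(u)$. For $U\subseteq V$, $\rho_U=\sum_{v\in U}\alpha_v e_v$, so $\|\rho_U\|^2=\sum_{v\in U}\alpha_v^2$. Predistance polynomials: on real polynomials of degree at most $d$ consider the scalar product $\langle p,q\rangle_\Gamma=\frac1n\operatorname{tr}(p(A)q(A))=\frac1n\sum_{i=0}^d m(\lambda_i)p(\lambda_i)q(\lambda_i)$. The predistance polynomials $p_0,p_1,\ldots,p_d$ are the orthogonal polynomials with respect to this product, with $\deg p_i=i$, normalized so that $\|p_i\|_\Gamma^2=p_i(\lambda_0)$ (it is known that $p_i(\lambda_0)>0$). Put $q_j=p_0+p_1+\cdots+p_j$ and $p_{\ge D}=q_d-q_{D-1}=p_D+p_{D+1}+\cdots+p_d$ (note $D\le d$). Weighted distance matrix: $A_D^*$ is the $V\times V$ matrix with $(A_D^* )_{uv}=\alpha_u\alpha_v$ if $\mathrm{dist}(u,v)=D$ and $0$ otherwise.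 *)

theory Defs
  imports
    "HOL-Analysis.Analysis"
    "HOL-Computational_Algebra.Polynomial"
    "Graph_Theory.Graph_Theory"
begin

text \<open>
  A finite simple graph is an instance of the locale \<^locale>\<open>graph\<close> (symmetric digraph without
  loops and parallel arcs).  Vertex sets are whole finite types, so that matrices indexed by
  vertices are elements of \<open>real ^ 'v ^ 'v\<close>.
\<close>

definition adj_matrix :: "('v::finite, 'e) pre_digraph \<Rightarrow> real ^ 'v ^ 'v" where
  "adj_matrix G = (\<chi> u v. if (u, v) \<in> arcs_ends G then 1 else 0)"

text \<open>The least length of a walk from \<open>u\<close> to \<open>v\<close>; only meaningful if there is such a walk.\<close>

definition graph_dist :: "('v, 'e) pre_digraph \<Rightarrow> 'v \<Rightarrow> 'v \<Rightarrow> nat" where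
  "graph_dist G u v = (LEAST k. \<exists>w. pre_digraph.awalk G u w v \<and> length w = k)"

definition graph_diam :: "('v, 'e) pre_digraph \<Rightarrow> nat" where
  "graph_diam G = Max {graph_dist G u v | u v. u \<in> verts G \<and> v \<in> verts G}"

definition sphere_at :: "('v, 'e) pre_digraph \<Rightarrow> nat \<Rightarrow> 'v \<Rightarrow> 'v set" where
  "sphere_at G i u = {v \<in> verts G. graph_dist G u v = i}"

definition nbhd :: "('v, 'e) pre_digraph \<Rightarrow> nat \<Rightarrow> 'v \<Rightarrow> 'v set" where
  "nbhd G j u = (\<Union>i\<le>j. sphere_at G i u)"

definition eigenvalues :: "real ^ 'v ^ 'v \<Rightarrow> real set" where
  "eigenvalues A = {c. \<exists>x. x \<noteq> 0 \<and> A *v x = c *\<^sub>R x}"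

definition max_eigenvalue :: "real ^ 'v ^ 'v \<Rightarrow> real" where
  "max_eigenvalue A = Max (eigenvalues A)"

text \<open>\<open>(^)\<close> on \<open>real ^ 'v ^ 'v\<close> would be the entrywise power.\<close>

primrec mat_power :: "real ^ 'v ^ 'v \<Rightarrow> nat \<Rightarrow> real ^ 'v ^ 'v" where
  "mat_power A 0 = mat 1"
| "mat_power A (Suc k) = A ** mat_power A k"

definition mat_poly :: "real poly \<Rightarrow> real ^ 'v ^ 'v \<Rightarrow> real ^ 'v ^ 'v" where
  "mat_poly p A = (\<Sum>i\<le>degree p. coeff p i *\<^sub>R mat_power A i)"

definition is_perron_vector :: "real ^ 'v ^ 'v \<Rightarrow> real ^ 'v \<Rightarrow> bool" where
  "is_perron_vector A \<alpha> \<longleftrightarrow>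
     A *v \<alpha> = max_eigenvalue A *\<^sub>R \<alpha> \<and> (\<forall>u. \<alpha> $ u > 0) \<and> (norm \<alpha>)\<^sup>2 = real CARD('v)"

definition rho :: "real ^ 'v \<Rightarrow> 'v set \<Rightarrow> real ^ 'v" where
  "rho \<alpha> U = (\<Sum>v\<in>U. (\<alpha> $ v) *\<^sub>R axis v 1)"

definition poly_inner :: "real ^ 'v ^ 'v \<Rightarrow> real poly \<Rightarrow> real poly \<Rightarrow> real" where
  "poly_inner A p q = trace (mat_poly p A ** mat_poly q A) / real CARD('v)"

text \<open>The number \<open>d\<close>, where the distinct eigenvalues are \<open>\<lambda>\<^sub>0 > \<dots> > \<lambda>\<^sub>d\<close>.\<close>

definition spec_d :: "real ^ 'v ^ 'v \<Rightarrow> nat" where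
  "spec_d A = card (eigenvalues A) - 1"

text \<open>
  These conditions determine \<open>P 0, \<dots>, P d\<close> uniquely; \<open>P i\<close> is unconstrained for \<open>i > d\<close>.
  Since \<open>degree 0 = 0\<close>, the case \<open>P 0 = 0\<close> has to be excluded separately.
\<close>

definition predistance_polys :: "real ^ 'v ^ 'v \<Rightarrow> (nat \<Rightarrow> real poly) \<Rightarrow> bool" where
  "predistance_polys A P \<longleftrightarrow>
     (\<forall>i\<le>spec_d A. degree (P i) = i) \<and>
     (\<forall>i\<le>spec_d A. \<forall>j\<le>spec_d A. i \<noteq> j \<longrightarrow> poly_inner A (P i) (P j) = 0) \<and>
     (\<forall>i\<le>spec_d A. P i \<noteq> 0 \<and> poly_inner A (P i) (P i) = poly (P i) (max_eigenvalue A))"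

definition weighted_dist_matrix ::
    "('v::finite, 'e) pre_digraph \<Rightarrow> real ^ 'v \<Rightarrow> nat \<Rightarrow> real ^ 'v ^ 'v" where
  "weighted_dist_matrix G \<alpha> i = (\<chi> u v. if graph_dist G u v = i then \<alpha> $ u * \<alpha> $ v else 0)"

text \<open>\<open>n\<close> divided by the sum of the reciprocals of \<open>(norm (rho \<alpha> (nbhd G j u)))\<^sup>2 / (\<alpha> $ u)\<^sup>2\<close>.\<close>

definition weighted_harmonic_mean ::
    "('v::finite, 'e) pre_digraph \<Rightarrow> real ^ 'v \<Rightarrow> nat \<Rightarrow> real" where
  "weighted_harmonic_mean G \<alpha> j =
     real CARD('v) / (\<Sum>u\<in>UNIV. (\<alpha> $ u)\<^sup>2 / (norm (rho \<alpha> (nbhd G j u)))\<^sup>2)"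

definition weighted_arith_mean ::
    "('v::finite, 'e) pre_digraph \<Rightarrow> real ^ 'v \<Rightarrow> nat \<Rightarrow> real" where
  "weighted_arith_mean G \<alpha> i =
     (\<Sum>u\<in>UNIV. (\<alpha> $ u)\<^sup>2 * (norm (rho \<alpha> (sphere_at G i u)))\<^sup>2) / real CARD('v)"

end

theory Submission
  imports Defs
begin

text \<open>
  Write \<open>\<Sum>\<close> over all vertices throughout.  Let \<open>q = P 0 + \<dots> + P (D - 1)\<close> and \<open>Q = q(A)\<close>, and let
  \<open>X\<^sub>u\<close> be the squared norm of \<open>\<rho>\<close> on the ball of radius \<open>D - 1\<close> around \<open>u\<close>.

  The sum of all predistance polynomials is the Hoffman polynomial: its value at \<open>A\<close> is the
  rank-one matrix \<open>\<alpha> \<alpha>\<^sup>T\<close> (\<open>mat_poly_sum_predistance\<close>).  Indeed both matrices have scalar product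
  \<open>n p(\<lambda>\<^sub>0)\<close> with every \<open>p(A)\<close>, \<open>deg p \<le> d\<close>, and both are themselves polynomials in \<open>A\<close> of such a degree; that
  \<open>\<alpha> \<alpha>\<^sup>T\<close> is one rests on the spectral theorem and on the simplicity of \<open>\<lambda>\<^sub>0\<close>.  Consequently
  \<open>p\<^sub>\<ge>\<^sub>D(\<lambda>\<^sub>0) = n - q(\<lambda>\<^sub>0)\<close> and \<open>p\<^sub>\<ge>\<^sub>D(A) = \<alpha> \<alpha>\<^sup>T - Q\<close>, so that the first inequality becomes \<open>q(\<lambda>\<^sub>0) \<le> H\<close>.

  As \<open>q\<close> has degree at most \<open>D - 1\<close>, row \<open>u\<close> of \<open>Q\<close> is supported on the ball around \<open>u\<close>, hence its
  scalar product with the restriction of \<open>\<alpha>\<close> to that ball is \<open>(Q \<alpha>)\<^sub>u = q(\<lambda>\<^sub>0) \<alpha>\<^sub>u\<close>.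
  Subtracting from each row its projection onto the restricted \<open>\<alpha>\<close> leaves residuals whose squared
  norms add up to \<open>tr Q\<^sup>2 - q(\<lambda>\<^sub>0)\<^sup>2 \<Sum> \<alpha>\<^sub>u\<^sup>2 / X\<^sub>u\<close> (\<open>matrix_residual\<close>).  The normalization of the
  predistance polynomials gives \<open>tr Q\<^sup>2 = n q(\<lambda>\<^sub>0)\<close>, and the sum \<open>S\<close> on the right is \<open>n / H\<close>, so
  the residuals add up to \<open>q(\<lambda>\<^sub>0) S (H - q(\<lambda>\<^sub>0))\<close>.  As \<open>q(\<lambda>\<^sub>0) > 0\<close>, this is the first inequality, with
  equality exactly when all residuals vanish.  In that case the symmetry of \<open>Q\<close> forces \<open>X\<close> to be constant
  (\<open>ball_weight_constant\<close>), its value is \<open>q(\<lambda>\<^sub>0)\<close>, and \<open>Q\<close> is \<open>\<alpha> \<alpha>\<^sup>T\<close> restricted to the pairs at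
  distance less than \<open>D\<close>.

  Since \<open>\<rho>\<close> on the sphere of radius \<open>D\<close> has squared norm \<open>n - X\<^sub>u\<close>, the second inequality says that the
  harmonic mean of \<open>X\<close> with weights \<open>\<alpha>\<^sub>u\<^sup>2\<close> is at most the arithmetic mean with the same weights;
  for constant \<open>X\<close> both equal that constant.
\<close>

section \<open>Polynomials in a matrix\<close>

lemma mat_poly_eq_sum:
  assumes "degree p \<le> N"
  shows "mat_poly p A = (\<Sum>i\<le>N. coeff p i *\<^sub>R mat_power A i)"
  unfolding mat_poly_def using assms
  by (intro sum.mono_neutral_left) (auto simp: coeff_eq_0)

lemma mat_poly_0 [simp]: "mat_poly 0 A = 0"
  by (simp add: mat_poly_def)

lemma matrix_mult_sum_right: "A ** (\<Sum>i\<in>I. f i) = (\<Sum>i\<in>I. (A :: real^'n^'n) ** f i)"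
proof (cases "finite I")
  case True
  then show ?thesis
    by induction (auto simp: matrix_add_ldistrib)
qed simp

lemma matrix_mult_scaleR_right: "A ** (k *\<^sub>R B) = k *\<^sub>R ((A :: real^'n^'n) ** B)"
  by (simp add: matrix_matrix_mult_def vec_eq_iff sum_distrib_left mult.left_commute)

lemma matrix_mult_scaleR_left: "(k *\<^sub>R A) ** B = k *\<^sub>R ((A :: real^'n^'n) ** B)"
  by (simp add: matrix_matrix_mult_def vec_eq_iff sum_distrib_left mult.assoc)

lemma matrix_mult_add_left: "(A + B) ** C = (A :: real^'n^'n) ** C + B ** C"
  by (simp add: matrix_matrix_mult_def vec_eq_iff distrib_right sum.distrib)

lemma mat_poly_pCons: "mat_poly (pCons a p) A = a *\<^sub>R mat 1 + A ** mat_poly p A"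
proof -
  have "mat_poly (pCons a p) A = (\<Sum>i\<le>Suc (degree p). coeff (pCons a p) i *\<^sub>R mat_power A i)"
    by (intro mat_poly_eq_sum) (simp add: degree_pCons_le)
  also have "\<dots> = a *\<^sub>R mat 1 + (\<Sum>i\<le>degree p. coeff p i *\<^sub>R (A ** mat_power A i))"
    by (simp only: sum.atMost_Suc_shift) simp
  finally show ?thesis
    by (simp add: mat_poly_def matrix_mult_sum_right matrix_mult_scaleR_right)
qed

lemma mat_poly_add: "mat_poly (p + q) A = mat_poly p A + mat_poly q A"
proof -
  let ?N = "max (degree p) (degree q)"
  have "mat_poly (p + q) A = (\<Sum>i\<le>?N. coeff (p + q) i *\<^sub>R mat_power A i)"
    by (intro mat_poly_eq_sum degree_add_le_max)
  then show ?thesis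
    by (simp add: mat_poly_eq_sum[of p ?N] mat_poly_eq_sum[of q ?N] scaleR_add_left sum.distrib)
qed

lemma mat_poly_smult: "mat_poly (smult a p) A = a *\<^sub>R mat_poly p A"
  by (simp add: mat_poly_eq_sum[OF degree_smult_le] scaleR_sum_right mat_poly_def)

lemma mat_poly_diff: "mat_poly (p - q) A = mat_poly p A - mat_poly q A"
  using mat_poly_add[of "p - q" q A] by (simp add: algebra_simps)

lemma mat_poly_sum: "mat_poly (\<Sum>i\<in>I. f i) A = (\<Sum>i\<in>I. mat_poly (f i) A)"
  by (induction I rule: infinite_finite_induct) (auto simp: mat_poly_add)

lemma mat_poly_mult: "mat_poly (p * q) A = mat_poly p A ** mat_poly q A"
proof (induction p)
  case 0
  show ?case by simp
next
  case (pCons a p)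
  have "mat_poly (pCons a p * q) A = a *\<^sub>R mat_poly q A + A ** mat_poly (p * q) A"
    by (simp add: mat_poly_add mat_poly_smult mat_poly_pCons)
  then show ?case
    by (simp add: pCons mat_poly_pCons matrix_mult_add_left matrix_mult_scaleR_left
        matrix_mul_assoc)
qed

lemma mat_poly_linear [simp]: "mat_poly [:- c, 1:] A = A - c *\<^sub>R mat 1"
  by (simp add: mat_poly_pCons)

lemma mat_poly_commute: "mat_poly p A ** mat_poly q A = mat_poly q A ** mat_poly p A"
  by (simp add: mult.commute flip: mat_poly_mult)

lemma mat_poly_commute_matrix: "A ** mat_poly p A = mat_poly p A ** A"
  using mat_poly_commute[of "[:0, 1:]" A p] by (simp add: mat_poly_pCons)

lemma mat_poly_eigenvector:
  assumes "A *v x = c *\<^sub>R x"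
  shows "mat_poly p A *v x = poly p c *\<^sub>R x"
proof (induction p)
  case (pCons a p)
  have "A *v (mat_poly p A *v x) = (c * poly p c) *\<^sub>R x"
    by (simp add: pCons matrix_vector_mult_scaleR assms mult.commute)
  then show ?case
    by (simp add: mat_poly_pCons matrix_vector_mult_add_rdistrib matrix_vector_mul_assoc
        scaleR_add_left flip: scaleR_matrix_vector_assoc)
qed simp

lemma transpose_mat_poly:
  assumes "transpose A = A"
  shows "transpose (mat_poly p A) = mat_poly p A"
proof (induction p)
  case (pCons a p)
  have "transpose (mat_poly (pCons a p) A) = a *\<^sub>R mat 1 + transpose (A ** mat_poly p A)"
    by (simp add: mat_poly_pCons transpose_def vec_eq_iff mat_def eq_commute)
  then show ?case
    by (simp add: matrix_transpose_mul assms pCons mat_poly_pCons mat_poly_commute_matrix)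
qed (simp add: transpose_def vec_eq_iff)

section \<open>Spectra of symmetric matrices\<close>

lemma symmetric_matrix_inner:
  fixes A :: "real^'n^'n"
  assumes "transpose A = A"
  shows "(A *v x) \<bullet> y = x \<bullet> (A *v y)"
  using assms by (metis dot_lmul_matrix transpose_matrix_vector)

text \<open>
  The Rayleigh quotient attains its maximum \<open>c\<close> over the unit sphere of \<open>W\<close> at some \<open>w\<close>.  The
  vector \<open>z = A w - c w\<close> lies in \<open>W\<close>, and maximality along the line \<open>w + t z\<close> forces \<open>z = 0\<close>.
\<close>
lemma symmetric_invariant_subspace_eigenvector:
  fixes A :: "real^'n^'n"
  assumes sym: "transpose A = A" and W: "subspace W"
    and inv: "\<And>x. x \<in> W \<Longrightarrow> A *v x \<in> W" and "x0 \<in> W" "x0 \<noteq> 0"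
  obtains w c where "w \<in> W" "w \<noteq> 0" "A *v w = c *\<^sub>R w"
proof -
  let ?f = "\<lambda>x. x \<bullet> (A *v x)"
  have cpt: "compact (W \<inter> sphere 0 1)"
    by (intro closed_Int_compact closed_subspace W compact_sphere)
  have "(1 / norm x0) *\<^sub>R x0 \<in> W \<inter> sphere 0 1"
    using assms by (auto intro: subspace_scale)
  then have ne: "W \<inter> sphere 0 1 \<noteq> {}" by blast
  have cont: "continuous_on (W \<inter> sphere 0 1) ?f"
    by (intro continuous_intros)
  obtain w where w: "w \<in> W" "norm w = 1"
    and max: "\<And>x. x \<in> W \<Longrightarrow> norm x = 1 \<Longrightarrow> ?f x \<le> ?f w"
    using continuous_attains_sup[OF cpt ne cont] by auto
  define c where "c = ?f w"
  have rayleigh: "?f x \<le> c * (x \<bullet> x)" if "x \<in> W" for x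
  proof (cases "x = 0")
    case False
    have "?f ((1 / norm x) *\<^sub>R x) \<le> c"
      unfolding c_def using that False by (intro max) (auto intro: subspace_scale W)
    then show ?thesis
      using False by (simp add: matrix_vector_mult_scaleR field_simps
          flip: power2_norm_eq_inner power2_eq_square)
  qed simp
  define z where "z = A *v w - c *\<^sub>R w"
  define K where "K = c * (z \<bullet> z) - ?f z"
  have z: "z \<in> W"
    unfolding z_def using w inv W by (simp add: subspace_diff subspace_scale)
  have wz: "w \<bullet> (A *v z) = (A *v w) \<bullet> z"
    by (simp add: symmetric_matrix_inner sym)
  have zz: "z \<bullet> z = (A *v w) \<bullet> z - c * (w \<bullet> z)"
    by (simp add: z_def inner_diff_left)
  have ww: "w \<bullet> w = 1"
    using w by (simp add: dot_square_norm)
  \<comment> \<open>The first-order gain \<open>2 t (z \<bullet> z)\<close> in direction \<open>z\<close> is outweighed by a multiple of \<open>t\<^sup>2\<close>.\<close>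
  have quad: "2 * t * (z \<bullet> z) \<le> t\<^sup>2 * K" for t
  proof -
    have "?f (w + t *\<^sub>R z) \<le> c * ((w + t *\<^sub>R z) \<bullet> (w + t *\<^sub>R z))"
      using w z W by (intro rayleigh) (simp add: subspace_add subspace_scale)
    moreover have "?f (w + t *\<^sub>R z) = c + 2 * t * ((A *v w) \<bullet> z) + t\<^sup>2 * ?f z"
      by (simp add: matrix_vector_right_distrib matrix_vector_mult_scaleR inner_add_left
          inner_add_right wz c_def inner_commute[of z "A *v w"] power2_eq_square
          distrib_left mult.assoc)
    moreover have "(w + t *\<^sub>R z) \<bullet> (w + t *\<^sub>R z) = 1 + 2 * t * (w \<bullet> z) + t\<^sup>2 * (z \<bullet> z)"
      by (simp add: inner_add_left inner_add_right ww inner_commute[of z w] power2_eq_square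
          distrib_left mult.assoc)
    ultimately have "c + 2 * t * ((A *v w) \<bullet> z) + t\<^sup>2 * ?f z
        \<le> c * (1 + 2 * t * (w \<bullet> z) + t\<^sup>2 * (z \<bullet> z))"
      by (simp only:)
    moreover have "2 * t * (z \<bullet> z) = 2 * t * ((A *v w) \<bullet> z) - 2 * t * c * (w \<bullet> z)"
      unfolding zz by (simp add: algebra_simps)
    ultimately show ?thesis
      by (simp add: K_def algebra_simps)
  qed
  have "z \<bullet> z \<le> 0"
  proof (cases "K \<le> 0")
    case True
    then show ?thesis using quad[of 1] by simp
  next
    case False
    then have "2 * (z \<bullet> z)\<^sup>2 \<le> (z \<bullet> z)\<^sup>2"
      using quad[of "(z \<bullet> z) / K"] by (simp add: field_simps power2_eq_square)
    then show ?thesis by simp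
  qed
  then have "z = 0"
    using inner_gt_zero_iff[of z] by linarith
  then show ?thesis
    using w that[of w c] by (force simp: z_def)
qed

text \<open>
  Eigenvectors for distinct eigenvalues are orthogonal, and an orthogonal family is finite.
\<close>
lemma finite_eigenvalues_symmetric:
  fixes A :: "real^'n^'n"
  assumes sym: "transpose A = A"
  shows "finite (eigenvalues A)"
proof -
  obtain f where f: "\<And>c. c \<in> eigenvalues A \<Longrightarrow> f c \<noteq> 0 \<and> A *v f c = c *\<^sub>R f c"
  proof -
    have "\<forall>c\<in>eigenvalues A. \<exists>x. x \<noteq> 0 \<and> A *v x = c *\<^sub>R x"
      by (simp add: eigenvalues_def)
    then show ?thesis using that by (metis (no_types, lifting))
  qed
  have inj: "inj_on f (eigenvalues A)"
    by (intro inj_onI) (metis f scaleR_cancel_right)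
  have orth: "f a \<bullet> f b = 0" if "a \<in> eigenvalues A" "b \<in> eigenvalues A" "a \<noteq> b" for a b
  proof -
    have "(A *v f a) \<bullet> f b = f a \<bullet> (A *v f b)"
      by (rule symmetric_matrix_inner[OF sym])
    then show ?thesis
      using f that by simp
  qed
  have "pairwise orthogonal (f ` eigenvalues A)"
    unfolding pairwise_def orthogonal_def using orth by auto
  then show ?thesis
    using pairwise_orthogonal_imp_finite inj finite_imageD by blast
qed

text \<open>
  This is the form in which the spectral theorem is used.  The range of the matrix \<open>M\<close> in question
  is \<open>A\<close>-invariant, so if it were nonzero it would contain an eigenvector \<open>w = M y\<close> of \<open>A\<close>.  But \<open>M\<close>
  kills all eigenvectors, and a symmetric \<open>M\<close> with \<open>M (M y) = 0\<close> has \<open>M y = 0\<close>.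
\<close>
lemma symmetric_spectral_annihilator:
  fixes A :: "real^'n^'n"
  assumes sym: "transpose A = A"
  shows "mat_poly (\<Prod>c\<in>eigenvalues A. [:- c, 1:]) A = 0"
proof (rule ccontr)
  define m where "m = (\<Prod>c\<in>eigenvalues A. [:- c, 1:])"
  let ?M = "mat_poly m A"
  assume "mat_poly (\<Prod>c\<in>eigenvalues A. [:- c, 1:]) A \<noteq> 0"
  then obtain x where x: "?M *v x \<noteq> 0"
    unfolding m_def by (metis matrix_eq matrix_vector_mult_0)
  have "subspace (range ((*v) ?M))"
    by (intro linear_subspace_image) auto
  moreover have "A *v y \<in> range ((*v) ?M)" if "y \<in> range ((*v) ?M)" for y
    using that by (auto simp: matrix_vector_mul_assoc mat_poly_commute_matrix)
       (metis matrix_vector_mul_assoc rangeI)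
  ultimately obtain w c where "w \<in> range ((*v) ?M)" and w: "w \<noteq> 0" "A *v w = c *\<^sub>R w"
    using symmetric_invariant_subspace_eigenvector[OF sym, of "range ((*v) ?M)"] x by blast
  then obtain y where y: "w = ?M *v y" by auto
  have "c \<in> eigenvalues A"
    using w by (auto simp: eigenvalues_def)
  then have "poly m c = 0"
    using finite_eigenvalues_symmetric[OF sym] by (auto simp: m_def poly_prod)
  then have "?M *v w = 0"
    by (simp add: mat_poly_eigenvector[OF w(2)])
  then have "w \<bullet> w = 0"
    by (metis inner_zero_right symmetric_matrix_inner sym transpose_mat_poly y)
  with w show False by simp
qed

text \<open>
  Omitting the factor of \<open>c\<close> from the annihilating product gives a polynomial \<open>g\<close> such that every
  column of \<open>g(A)\<close> lies in the eigenspace of \<open>c\<close>, hence is a multiple of \<open>\<alpha>\<close>.  By symmetry \<open>g(A)\<close> is a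
  multiple of \<open>\<alpha> \<alpha>\<^sup>T\<close>, and \<open>g(c) \<noteq> 0\<close> allows it to be rescaled.
\<close>
lemma hoffman_polynomial:
  fixes A :: "real^'n^'n"
  assumes sym: "transpose A = A" and eig: "A *v \<alpha> = c *\<^sub>R \<alpha>" "\<alpha> \<noteq> 0"
    and simple: "\<And>x. A *v x = c *\<^sub>R x \<Longrightarrow> \<exists>k. x = k *\<^sub>R \<alpha>"
  obtains h where "degree h \<le> spec_d A" "mat_poly h A = (\<chi> u v. \<alpha> $ u * \<alpha> $ v)"
proof -
  note fin = finite_eigenvalues_symmetric[OF sym]
  have c: "c \<in> eigenvalues A"
    using eig by (auto simp: eigenvalues_def)
  define g where "g = (\<Prod>b\<in>eigenvalues A - {c}. [:- b, 1:])"
  let ?M = "mat_poly g A"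
  have deg: "degree g = spec_d A"
    unfolding g_def spec_d_def using c fin
    by (subst degree_prod_eq_sum_degree) (auto simp: card_Diff_singleton)
  have "(\<Prod>b\<in>eigenvalues A. [:- b, 1:]) = [:- c, 1:] * g"
    unfolding g_def using c fin by (rule prod.remove[rotated])
  then have "(A - c *\<^sub>R mat 1) ** ?M = 0"
    using symmetric_spectral_annihilator[OF sym] by (simp add: mat_poly_mult del: mult_pCons_left)
  then have "(A - c *\<^sub>R mat 1) *v (?M *v x) = 0" for x
    by (simp add: matrix_vector_mul_assoc)
  then have "A *v (?M *v x) = c *\<^sub>R (?M *v x)" for x
    by (simp add: matrix_vector_mult_diff_rdistrib flip: scaleR_matrix_vector_assoc)
  then have "\<exists>k. ?M *v x = k *\<^sub>R \<alpha>" for x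
    by (intro simple)
  then obtain k where k: "\<And>x. ?M *v x = k x *\<^sub>R \<alpha>"
    by metis
  have M\<alpha>: "?M *v \<alpha> = poly g c *\<^sub>R \<alpha>"
    by (rule mat_poly_eigenvector[OF eig(1)])
  have nz: "poly g c \<noteq> 0"
    using fin by (auto simp: g_def poly_prod)
  have kx: "k x * (\<alpha> \<bullet> \<alpha>) = poly g c * (x \<bullet> \<alpha>)" for x
  proof -
    have "(?M *v x) \<bullet> \<alpha> = x \<bullet> (?M *v \<alpha>)"
      by (intro symmetric_matrix_inner transpose_mat_poly sym)
    then show ?thesis by (simp add: k[of x] M\<alpha>)
  qed
  define h where "h = smult ((\<alpha> \<bullet> \<alpha>) / poly g c) g"
  have "mat_poly h A *v x = (\<chi> u v. \<alpha> $ u * \<alpha> $ v) *v x" for x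
  proof -
    have "mat_poly h A *v x = ((\<alpha> \<bullet> \<alpha>) / poly g c * k x) *\<^sub>R \<alpha>"
      by (simp add: h_def mat_poly_smult k flip: scaleR_matrix_vector_assoc)
    also have "(\<alpha> \<bullet> \<alpha>) / poly g c * k x = x \<bullet> \<alpha>"
      using kx[of x] nz by (simp add: field_simps)
    also have "(x \<bullet> \<alpha>) *\<^sub>R \<alpha> = (\<chi> u v. \<alpha> $ u * \<alpha> $ v) *v x"
      by (simp add: vec_eq_iff matrix_vector_mult_def inner_vec_def sum_distrib_left sum_distrib_right
          algebra_simps)
    finally show ?thesis .
  qed
  then have "mat_poly h A = (\<chi> u v. \<alpha> $ u * \<alpha> $ v)"
    by (simp add: matrix_eq)
  moreover have "degree h \<le> spec_d A"
    unfolding h_def using degree_smult_le deg by metis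
  ultimately show ?thesis using that by blast
qed

section \<open>Predistance polynomials\<close>

text \<open>
  For symmetric \<open>A\<close> the trace form is the Euclidean inner product of matrices, which makes
  bilinearity and definiteness available without any diagonalization.
\<close>
lemma poly_inner_frobenius:
  assumes "transpose A = A"
  shows "poly_inner A p q = (mat_poly p A \<bullet> mat_poly q (A :: real^'n^'n)) / real CARD('n)"
proof -
  have "mat_poly q A $ i $ j = mat_poly q A $ j $ i" for i j
    using transpose_mat_poly[OF assms, of q] by (metis (lifting) transpose_def vec_lambda_beta)
  then show ?thesis
    by (simp add: poly_inner_def trace_def matrix_matrix_mult_def inner_vec_def)
qed

lemma inner_outer_product:
  "(\<chi> u v. \<alpha> $ u * \<alpha> $ v) \<bullet> M = \<alpha> \<bullet> (M *v \<alpha>)" for M :: "real^'n^'n"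
  by (simp add: inner_vec_def matrix_vector_mult_def sum_distrib_left algebra_simps)

lemma predistance_frobenius:
  fixes A :: "real^'n^'n"
  assumes sym: "transpose A = A" and P: "predistance_polys A P"
    and ij: "i \<le> spec_d A" "j \<le> spec_d A"
  shows "mat_poly (P i) A \<bullet> mat_poly (P j) A
    = (if i = j then real CARD('n) * poly (P i) (max_eigenvalue A) else 0)"
proof -
  have "poly_inner A (P i) (P j) = (if i = j then poly (P i) (max_eigenvalue A) else 0)"
    using P ij by (auto simp: predistance_polys_def)
  then show ?thesis
    by (auto simp: poly_inner_frobenius[OF sym] field_simps split: if_splits)
qed

text \<open>
  With \<open>I = J\<close> this computes the norm of a partial sum; with \<open>I = {..d}\<close> and \<open>J\<close> a singleton it is
  the reproducing property of the full sum.
\<close>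
lemma predistance_sum_frobenius:
  fixes A :: "real^'n^'n"
  assumes sym: "transpose A = A" and P: "predistance_polys A P" and I: "I \<subseteq> {..spec_d A}"
    and J: "J \<subseteq> I"
  shows "mat_poly (\<Sum>i\<in>I. P i) A \<bullet> mat_poly (\<Sum>i\<in>J. P i) A
    = real CARD('n) * poly (\<Sum>i\<in>J. P i) (max_eigenvalue A)"
proof -
  have fin: "finite I" "finite J"
    using finite_subset[OF I] finite_subset[OF J] by auto
  have "mat_poly (\<Sum>i\<in>I. P i) A \<bullet> mat_poly (\<Sum>i\<in>J. P i) A
    = (\<Sum>j\<in>J. \<Sum>i\<in>I. mat_poly (P i) A \<bullet> mat_poly (P j) A)"
    by (simp only: mat_poly_sum inner_sum_left inner_sum_right)
  also have "\<dots> = (\<Sum>j\<in>J. \<Sum>i\<in>I. if i = j then real CARD('n) * poly (P i) (max_eigenvalue A) else 0)"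
    using I J by (intro sum.cong refl predistance_frobenius sym P) auto
  also have "\<dots> = (\<Sum>j\<in>J. real CARD('n) * poly (P j) (max_eigenvalue A))"
    using J fin by (intro sum.cong) auto
  finally show ?thesis
    by (simp add: poly_sum sum_distrib_left)
qed

text \<open>
  The first \<open>k + 1\<close> predistance polynomials have degrees \<open>0, \<dots>, k\<close> and hence span the polynomials
  of degree at most \<open>k\<close>.
\<close>
lemma predistance_orthogonal_complement:
  fixes M :: "real^'n^'n"
  assumes P: "predistance_polys A P" and "k \<le> spec_d A"
    and orth: "\<And>i. i \<le> spec_d A \<Longrightarrow> M \<bullet> mat_poly (P i) A = 0" and "degree p \<le> k"
  shows "M \<bullet> mat_poly p A = 0"
  using assms(2,4)
proof (induction k arbitrary: p rule: less_induct)
  case (less k)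
  have dP: "degree (P k) = k" and "P k \<noteq> 0"
    using P less.prems by (auto simp: predistance_polys_def)
  then have lc: "coeff (P k) k \<noteq> 0"
    using leading_coeff_0_iff by metis
  define r where "r = p - smult (coeff p k / coeff (P k) k) (P k)"
  have "degree r \<le> k"
    unfolding r_def using less.prems dP
    by (intro degree_diff_le) (auto intro: order.trans[OF degree_smult_le])
  moreover have "coeff r k = 0"
    using lc by (simp add: r_def)
  ultimately have "r = 0 \<or> degree r < k"
    using eq_zero_or_degree_less by blast
  then have "M \<bullet> mat_poly r A = 0"
    using less.IH[of "degree r" r] less.prems by auto
  then show ?case
    using orth[of k] less.prems
    by (simp add: r_def mat_poly_diff mat_poly_smult inner_diff_right)
qed

text \<open>
  Let \<open>h\<close> be the Hoffman polynomial and \<open>q\<close> the full sum.  Both represent evaluation at \<open>\<lambda>\<^sub>0\<close>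
  with respect to the trace form, so \<open>(q - h)(A)\<close> is orthogonal to every polynomial in \<open>A\<close>
  of degree at most \<open>d\<close>, in particular to itself.
\<close>
lemma mat_poly_sum_predistance:
  fixes A :: "real^'n^'n"
  assumes sym: "transpose A = A" and P: "predistance_polys A P" and \<alpha>: "is_perron_vector A \<alpha>"
    and simple: "\<And>x. A *v x = max_eigenvalue A *\<^sub>R x \<Longrightarrow> \<exists>k. x = k *\<^sub>R \<alpha>"
  shows "mat_poly (\<Sum>i\<le>spec_d A. P i) A = (\<chi> u v. \<alpha> $ u * \<alpha> $ v)"
proof -
  have eig: "A *v \<alpha> = max_eigenvalue A *\<^sub>R \<alpha>" and norm: "\<alpha> \<bullet> \<alpha> = real CARD('n)"
    using \<alpha> by (auto simp: is_perron_vector_def power2_norm_eq_inner)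
  then have "\<alpha> \<noteq> 0" by auto
  then obtain h where h: "degree h \<le> spec_d A" "mat_poly h A = (\<chi> u v. \<alpha> $ u * \<alpha> $ v)"
    using hoffman_polynomial[OF sym eig _ simple] by blast
  define q where "q = (\<Sum>i\<le>spec_d A. P i)"
  let ?R = "mat_poly (q - h) A"
  have orth: "?R \<bullet> mat_poly (P i) A = 0" if "i \<le> spec_d A" for i
    using predistance_sum_frobenius[OF sym P, of "{..spec_d A}" "{i}"] that
    by (simp add: q_def mat_poly_diff h inner_diff_left inner_outer_product
        mat_poly_eigenvector[OF eig] norm)
  have "degree q \<le> spec_d A"
    unfolding q_def using P by (intro degree_sum_le) (auto simp: predistance_polys_def)
  then have "?R \<bullet> ?R = 0"
    using h by (intro predistance_orthogonal_complement[OF P order.refl orth] degree_diff_le) auto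
  then show ?thesis
    using h by (simp add: mat_poly_diff q_def)
qed

section \<open>Distances and the Perron eigenspace of a connected graph\<close>

text \<open>
  The vertex set is the whole type, so that vectors and matrices over the type are indexed exactly
  by the vertices.
\<close>
locale connected_full_graph = graph G for G :: "('v::finite, 'e) pre_digraph" +
  assumes verts_UNIV: "verts G = UNIV" and conn: "Digraph_Component.connected G"
begin

lemma arcs_ends_sym: "(u, v) \<in> arcs_ends G \<Longrightarrow> (v, u) \<in> arcs_ends G"
  using sym_arcs by (auto simp: symmetric_def sym_def)

lemma arcs_ends_rtrancl: "(u, v) \<in> (arcs_ends G)\<^sup>*"
proof -
  have "u \<rightarrow>\<^sup>*\<^bsub>G\<^esub> v"
    using conn verts_UNIV reachable_mk_symmetric_eq[OF sym_arcs]
    by (auto simp: Digraph_Component.connected_def strongly_connected_def)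
  then show ?thesis
    unfolding reachable_def by (rule rtrancl_on_rtranclI)
qed

lemma constant_along_arcs:
  assumes "\<And>u v. (u, v) \<in> arcs_ends G \<Longrightarrow> f u = f v"
  shows "f u = f v"
  using arcs_ends_rtrancl[of u v] by induction (auto dest: assms)

text \<open>
  Relation powers replace walks from here on, since they match the recursion of matrix powers.
\<close>
lemma awalk_length_iff: "(\<exists>w. awalk u w v \<and> length w = k) \<longleftrightarrow> (u, v) \<in> arcs_ends G ^^ k"
proof (induction k arbitrary: u)
  case 0
  show ?case by (auto simp: awalk_Nil_iff verts_UNIV)
next
  case (Suc k)
  have "(\<exists>w. awalk u w v \<and> length w = Suc k)
    \<longleftrightarrow> (\<exists>e\<in>arcs G. u = tail G e \<and> (\<exists>w. awalk (head G e) w v \<and> length w = k))"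
    by (simp only: length_Suc_conv) (metis awalk_Cons_iff)
  also have "\<dots> \<longleftrightarrow> (\<exists>x. (u, x) \<in> arcs_ends G \<and> (x, v) \<in> arcs_ends G ^^ k)"
    unfolding Suc by (auto simp: arcs_ends_conv)
  also have "\<dots> \<longleftrightarrow> (u, v) \<in> arcs_ends G ^^ Suc k"
    by (metis relpow_Suc_D2 relpow_Suc_I2)
  finally show ?case .
qed

lemma graph_dist_relpow: "graph_dist G u v = (LEAST k. (u, v) \<in> arcs_ends G ^^ k)"
  by (simp add: graph_dist_def awalk_length_iff)

lemma graph_dist_le: "(u, v) \<in> arcs_ends G ^^ k \<Longrightarrow> graph_dist G u v \<le> k"
  unfolding graph_dist_relpow by (rule Least_le)

lemma graph_dist_walk: "(u, v) \<in> arcs_ends G ^^ graph_dist G u v"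
  unfolding graph_dist_relpow using arcs_ends_rtrancl rtrancl_imp_relpow by (metis LeastI_ex)

lemma graph_dist_self [simp]: "graph_dist G u u = 0"
  using graph_dist_le[of u u 0] by simp

lemma graph_dist_eq_0D: "graph_dist G u v = 0 \<Longrightarrow> u = v"
  using graph_dist_walk[of u v] by simp

lemma graph_dist_eq_1D: "graph_dist G u v = 1 \<Longrightarrow> (u, v) \<in> arcs_ends G"
  using graph_dist_walk[of u v] by simp

lemma graph_dist_arc_le: "(u, v) \<in> arcs_ends G \<Longrightarrow> graph_dist G u v \<le> 1"
  by (intro graph_dist_le) simp

lemma finite_graph_dists: "finite {graph_dist G u v | u v. u \<in> verts G \<and> v \<in> verts G}"
  by (rule finite_subset[of _ "(\<lambda>(u, v). graph_dist G u v) ` UNIV"]) auto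

lemma graph_dist_le_diam: "graph_dist G u v \<le> graph_diam G"
  unfolding graph_diam_def by (intro Max_ge finite_graph_dists) (auto simp: verts_UNIV)

lemma graph_diam_attained: obtains u v where "graph_dist G u v = graph_diam G"
proof -
  have "graph_diam G \<in> {graph_dist G u v | u v. u \<in> verts G \<and> v \<in> verts G}"
    unfolding graph_diam_def by (intro Max_in finite_graph_dists) (auto simp: verts_UNIV)
  then show ?thesis using that by auto
qed

lemma in_nbhd_iff: "v \<in> nbhd G j u \<longleftrightarrow> graph_dist G u v \<le> j"
  by (auto simp: nbhd_def sphere_at_def verts_UNIV)

lemma in_sphere_iff: "v \<in> sphere_at G i u \<longleftrightarrow> graph_dist G u v = i"
  by (auto simp: sphere_at_def verts_UNIV)

lemma transpose_adj_matrix: "transpose (adj_matrix G) = adj_matrix G"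
proof -
  have "(u, v) \<in> arcs_ends G \<longleftrightarrow> (v, u) \<in> arcs_ends G" for u v
    using arcs_ends_sym by blast
  then show ?thesis
    by (simp add: transpose_def adj_matrix_def vec_eq_iff)
qed

lemma adj_matrix_mult: "(adj_matrix G *v x) $ u = (\<Sum>v | (u, v) \<in> arcs_ends G. x $ v)"
proof -
  have "(adj_matrix G *v x) $ u = (\<Sum>v\<in>UNIV. if (u, v) \<in> arcs_ends G then x $ v else 0)"
    unfolding adj_matrix_def matrix_vector_mult_def by (auto intro!: sum.cong)
  then show ?thesis
    by (simp add: sum.If_cases)
qed

lemma mat_power_adj_eq_0:
  "k < graph_dist G u v \<Longrightarrow> mat_power (adj_matrix G) k $ u $ v = 0"
proof (induction k arbitrary: u)
  case 0
  then show ?case by (auto simp: mat_def)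
next
  case (Suc k)
  have "adj_matrix G $ u $ w * mat_power (adj_matrix G) k $ w $ v = 0" for w
  proof (cases "(u, w) \<in> arcs_ends G")
    case True
    have "graph_dist G u v \<le> Suc (graph_dist G w v)"
      by (intro graph_dist_le relpow_Suc_I2[OF True] graph_dist_walk)
    then have "k < graph_dist G w v" using Suc.prems by simp
    then show ?thesis by (simp add: Suc.IH)
  qed (simp add: adj_matrix_def)
  then show ?case
    by (simp only: mat_power.simps matrix_matrix_mult_def vec_lambda_beta sum.neutral_const)
qed

lemma mat_poly_adj_eq_0:
  "degree p < graph_dist G u v \<Longrightarrow> mat_poly p (adj_matrix G) $ u $ v = 0"
  by (simp add: mat_poly_def mat_power_adj_eq_0)

text \<open>
  Subtract from \<open>x\<close> the largest multiple \<open>t \<alpha>\<close> for which \<open>y = x - t \<alpha>\<close> remains nonnegative.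
  Then \<open>y\<close> has a zero coordinate, and the eigenvalue equation at a zero coordinate says that the
  nonnegative values of \<open>y\<close> at the neighbours add up to zero.  So zeros spread along arcs, and by
  connectedness \<open>y = 0\<close>.
\<close>
lemma positive_eigenvector_simple:
  assumes pos: "\<And>u. \<alpha> $ u > 0" and eig: "adj_matrix G *v \<alpha> = c *\<^sub>R \<alpha>"
    and x: "adj_matrix G *v x = c *\<^sub>R x"
  shows "\<exists>k. x = k *\<^sub>R \<alpha>"
proof -
  define t where "t = Min (range (\<lambda>u. x $ u / \<alpha> $ u))"
  define y where "y = x - t *\<^sub>R \<alpha>"
  have "t \<in> range (\<lambda>u. x $ u / \<alpha> $ u)"
    unfolding t_def by (intro Min_in) auto
  then obtain u0 where u0: "t = x $ u0 / \<alpha> $ u0" by auto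
  have t_le: "t \<le> x $ u / \<alpha> $ u" for u
    unfolding t_def by (intro Min_le) auto
  have y_nonneg: "y $ u \<ge> 0" for u
    using t_le[of u] pos[of u] by (simp add: y_def field_simps)
  have y0: "y $ u0 = 0"
    using pos[of u0] by (simp add: y_def u0)
  have y_eig: "adj_matrix G *v y = c *\<^sub>R y"
    by (simp add: y_def matrix_vector_mult_diff_distrib matrix_vector_mult_scaleR eig x
        scaleR_diff_right)
  have step: "y $ v = 0" if "y $ u = 0" "(u, v) \<in> arcs_ends G" for u v
  proof -
    have "(\<Sum>w | (u, w) \<in> arcs_ends G. y $ w) = 0"
      using y_eig that by (simp flip: adj_matrix_mult)
    then show ?thesis
      using that y_nonneg by (simp add: sum_nonneg_eq_0_iff)
  qed
  have "y $ v = 0" for v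
    using arcs_ends_rtrancl[of u0 v] by induction (auto simp: y0 intro: step)
  then have "y = 0" by (simp add: vec_eq_iff)
  then show ?thesis by (auto simp: y_def)
qed

text \<open>
  At a pair of vertices at distance \<open>graph_diam G\<close>, a polynomial in the adjacency matrix of smaller
  degree vanishes, whereas \<open>\<alpha> \<alpha>\<^sup>T\<close> does not.  Applied to the Hoffman polynomial this is the
  inequality \<open>D \<le> d\<close>.
\<close>
lemma graph_diam_le_degree:
  assumes "\<And>u. \<alpha> $ u > 0" and "mat_poly h (adj_matrix G) = (\<chi> u v. \<alpha> $ u * \<alpha> $ v)"
  shows "graph_diam G \<le> degree h"
proof (rule ccontr)
  assume "\<not> graph_diam G \<le> degree h"
  moreover obtain u v where "graph_dist G u v = graph_diam G"
    by (rule graph_diam_attained)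
  ultimately have "mat_poly h (adj_matrix G) $ u $ v = 0"
    by (intro mat_poly_adj_eq_0) simp
  then show False
    using assms(1)[of u] assms(1)[of v] by (simp add: assms(2))
qed

end

section \<open>Weighted neighbourhoods\<close>

lemma rho_component: "rho \<alpha> U $ v = (if v \<in> U then \<alpha> $ v else 0)"
proof -
  have "rho \<alpha> U $ v = (\<Sum>w\<in>U. if v = w then \<alpha> $ w else 0)"
    unfolding rho_def sum_component by (rule sum.cong) (auto simp: axis_def)
  then show ?thesis by simp
qed

lemma norm_rho: "(norm (rho \<alpha> U))\<^sup>2 = (\<Sum>v\<in>U. (\<alpha> $ v)\<^sup>2)"
proof -
  have "(norm (rho \<alpha> U))\<^sup>2 = (\<Sum>v\<in>UNIV. if v \<in> U then (\<alpha> $ v)\<^sup>2 else 0)"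
    unfolding power2_norm_eq_inner inner_vec_def
    by (rule sum.cong) (auto simp: rho_component power2_eq_square)
  then show ?thesis
    by (simp add: sum.If_cases)
qed

locale perron_graph = connected_full_graph G for G :: "('v::finite, 'e) pre_digraph" +
  fixes \<alpha> :: "real^'v"
  assumes perron: "is_perron_vector (adj_matrix G) \<alpha>"
begin

abbreviation "A \<equiv> adj_matrix G"
abbreviation "lam0 \<equiv> max_eigenvalue A"

definition ball_weight :: "nat \<Rightarrow> 'v \<Rightarrow> real" where
  "ball_weight j u = (norm (rho \<alpha> (nbhd G j u)))\<^sup>2"

lemma perron_pos: "\<alpha> $ u > 0"
  and perron_eigenvector: "A *v \<alpha> = lam0 *\<^sub>R \<alpha>"
  and sum_perron_squares: "(\<Sum>u\<in>UNIV. (\<alpha> $ u)\<^sup>2) = real CARD('v)"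
  using perron unfolding is_perron_vector_def power2_norm_eq_inner inner_vec_def
  by (auto simp: power2_eq_square)

lemma perron_simple: "A *v x = lam0 *\<^sub>R x \<Longrightarrow> \<exists>k. x = k *\<^sub>R \<alpha>"
  using positive_eigenvector_simple[OF perron_pos perron_eigenvector] .

lemma ball_norm_pos: "norm (rho \<alpha> (nbhd G j u)) > 0"
proof -
  have "rho \<alpha> (nbhd G j u) $ u \<noteq> 0"
    using perron_pos[of u] by (simp add: rho_component in_nbhd_iff)
  then show ?thesis by auto
qed

lemma ball_weight_pos: "ball_weight j u > 0"
  using ball_norm_pos by (simp add: ball_weight_def)

lemma sphere_weight:
  assumes "graph_diam G \<ge> 1"
  shows "(norm (rho \<alpha> (sphere_at G (graph_diam G) u)))\<^sup>2
    = real CARD('v) - ball_weight (graph_diam G - 1) u"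
proof -
  let ?S = "sphere_at G (graph_diam G) u" and ?N = "nbhd G (graph_diam G - 1) u"
  have "?S \<union> ?N = UNIV" "?S \<inter> ?N = {}"
    using graph_dist_le_diam[of u] assms
    by (auto simp: in_sphere_iff in_nbhd_iff) (metis Suc_pred le_Suc_eq less_eq_Suc_le One_nat_def)
  then have "(\<Sum>v\<in>?S. (\<alpha> $ v)\<^sup>2) + (\<Sum>v\<in>?N. (\<alpha> $ v)\<^sup>2) = real CARD('v)"
    by (metis finite sum.union_disjoint sum_perron_squares)
  then show ?thesis by (simp add: norm_rho ball_weight_def)
qed

text \<open>
  The row is supported on the ball, so its inner product with the restricted Perron vector \<open>r\<close> is
  the same as with \<open>\<alpha>\<close>, namely \<open>p(\<lambda>\<^sub>0) \<alpha>\<^sub>u\<close>.  The vector subtracted is therefore the orthogonal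
  projection of the row onto \<open>r\<close>, and the identity is Pythagoras.
\<close>
lemma row_residual:
  assumes "degree p \<le> j"
  shows "(norm (mat_poly p A $ u
      - (poly p lam0 * \<alpha> $ u / ball_weight j u) *\<^sub>R rho \<alpha> (nbhd G j u)))\<^sup>2
    = mat_poly p A $ u \<bullet> mat_poly p A $ u - (poly p lam0)\<^sup>2 * ((\<alpha> $ u)\<^sup>2 / ball_weight j u)"
proof -
  let ?x = "mat_poly p A $ u" and ?r = "rho \<alpha> (nbhd G j u)" and ?X = "ball_weight j u"
  let ?k = "poly p lam0 * \<alpha> $ u / ?X"
  have "?x $ v = 0" if "v \<notin> nbhd G j u" for v
    using that assms by (intro mat_poly_adj_eq_0) (simp add: in_nbhd_iff)
  then have "?x \<bullet> ?r = ?x \<bullet> \<alpha>"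
    unfolding inner_vec_def by (intro sum.cong) (auto simp: rho_component)
  also have "\<dots> = poly p lam0 * \<alpha> $ u"
    using mat_poly_eigenvector[OF perron_eigenvector, of p]
    by (simp flip: matrix_vector_mul_component)
  finally have xr: "?x \<bullet> ?r = ?k * ?X"
    using ball_weight_pos[of j u] by simp
  have rr: "?r \<bullet> ?r = ?X"
    by (simp add: ball_weight_def power2_norm_eq_inner)
  have "(norm (x - k *\<^sub>R r))\<^sup>2 = x \<bullet> x - 2 * k * (x \<bullet> r) + k\<^sup>2 * (r \<bullet> r)"
    for x r :: "real^'v" and k
    unfolding power2_norm_eq_inner
    by (simp add: inner_diff_left inner_diff_right inner_commute[of r x] power2_eq_square
        algebra_simps)
  then have "(norm (?x - ?k *\<^sub>R ?r))\<^sup>2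
    = ?x \<bullet> ?x - 2 * ?k * (?x \<bullet> ?r) + ?k\<^sup>2 * (?r \<bullet> ?r)" .
  also have "\<dots> = ?x \<bullet> ?x - ?k\<^sup>2 * ?X"
    unfolding xr rr by (simp add: power2_eq_square)
  also have "?k\<^sup>2 * ?X = (poly p lam0)\<^sup>2 * ((\<alpha> $ u)\<^sup>2 / ?X)"
    using ball_weight_pos[of j u] by (simp add: field_simps power2_eq_square)
  finally show ?thesis .
qed

lemma matrix_residual:
  assumes "degree p \<le> j"
  shows "(\<Sum>u\<in>UNIV. (norm (mat_poly p A $ u
      - (poly p lam0 * \<alpha> $ u / ball_weight j u) *\<^sub>R rho \<alpha> (nbhd G j u)))\<^sup>2)
    = mat_poly p A \<bullet> mat_poly p A - (poly p lam0)\<^sup>2 * (\<Sum>u\<in>UNIV. (\<alpha> $ u)\<^sup>2 / ball_weight j u)"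
  unfolding row_residual[OF assms]
  by (simp add: sum_subtractf sum_distrib_left inner_vec_def)

text \<open>
  In a complete graph the eigenvalue equation reads \<open>(1 + \<lambda>\<^sub>0) \<alpha>\<^sub>u = \<Sum> \<alpha>\<^sub>w\<close>, with a right-hand
  side that is positive and independent of \<open>u\<close>.
\<close>
lemma perron_constant_if_diam_1:
  assumes "graph_diam G = 1"
  shows "\<alpha> $ u = \<alpha> $ v"
proof -
  have arcs: "{w. (u, w) \<in> arcs_ends G} = UNIV - {u}" for u
  proof -
    have "(u, w) \<in> arcs_ends G" if "w \<noteq> u" for w
      using that graph_dist_le_diam[of u w] graph_dist_eq_0D[of u w] assms
      by (intro graph_dist_eq_1D) force
    moreover have "(u, u) \<notin> arcs_ends G"
      using adj_not_same by blast
    ultimately show ?thesis by auto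
  qed
  have total: "(\<Sum>w\<in>UNIV. \<alpha> $ w) = (1 + lam0) * \<alpha> $ u" for u
  proof -
    have "lam0 * \<alpha> $ u = (\<Sum>w\<in>UNIV - {u}. \<alpha> $ w)"
      using adj_matrix_mult[of \<alpha> u] by (simp add: perron_eigenvector arcs)
    then show ?thesis
      by (simp add: sum.remove[of UNIV u] algebra_simps)
  qed
  have "(\<Sum>w\<in>UNIV. \<alpha> $ w) > 0"
    by (intro sum_pos) (auto simp: perron_pos)
  then have "1 + lam0 \<noteq> 0"
    using total[of u] by auto
  then show ?thesis
    using total[of u] total[of v] by simp
qed

text \<open>
  Let \<open>D = graph_diam G\<close>.  If \<open>D \<ge> 2\<close>, the two ends of an arc lie in each other's balls of radius \<open>D - 1\<close>, and comparing
  the entries of the symmetric matrix at \<open>(u, v)\<close> and \<open>(v, u)\<close> gives equal weights; connectedness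
  does the rest.  If \<open>D = 1\<close>, the balls are single vertices and both entries
  vanish, but then the graph is complete and the Perron vector itself is constant.
\<close>
lemma ball_weight_constant:
  assumes j: "j = graph_diam G - 1" "graph_diam G \<ge> 1" and nz: "poly p lam0 \<noteq> 0"
    and rows: "\<And>u. mat_poly p A $ u
      = (poly p lam0 * \<alpha> $ u / ball_weight j u) *\<^sub>R rho \<alpha> (nbhd G j u)"
  shows "ball_weight j u = ball_weight j v"
proof (cases "graph_diam G = 1")
  case True
  then have "nbhd G j u = {u}" for u
    using j by (auto simp: in_nbhd_iff dest: graph_dist_eq_0D)
  then show ?thesis
    using perron_constant_if_diam_1[OF True, of u v] by (simp add: ball_weight_def norm_rho)
next
  case False
  show ?thesis
  proof (rule constant_along_arcs)
    fix u v
    assume uv: "(u, v) \<in> arcs_ends G"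
    have entry: "mat_poly p A $ x $ y = poly p lam0 * (\<alpha> $ x * \<alpha> $ y) / ball_weight j x"
      if "(x, y) \<in> arcs_ends G" for x y
      using graph_dist_arc_le[OF that] False j
      by (simp add: rows rho_component in_nbhd_iff)
    have "mat_poly p A $ u $ v = mat_poly p A $ v $ u"
      using transpose_mat_poly[OF transpose_adj_matrix, of p]
      by (metis (lifting) transpose_def vec_lambda_beta)
    then show "ball_weight j u = ball_weight j v"
      using nz perron_pos[of u] perron_pos[of v] ball_weight_pos[of j u] ball_weight_pos[of j v]
      by (simp add: entry[OF uv] entry[OF arcs_ends_sym[OF uv]] field_simps)
  qed
qed

lemma harmonic_mean_ball_weight:
  "weighted_harmonic_mean G \<alpha> j = real CARD('v) / (\<Sum>u\<in>UNIV. (\<alpha> $ u)\<^sup>2 / ball_weight j u)"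
  by (simp add: weighted_harmonic_mean_def ball_weight_def)

lemma reciprocal_sum_pos: "(\<Sum>u\<in>UNIV. (\<alpha> $ u)\<^sup>2 / ball_weight j u) > 0"
  using perron_pos ball_weight_pos[of j]
  by (intro sum_pos) (auto simp: zero_less_divide_iff less_imp_neq[symmetric])

lemma harmonic_mean_constant:
  assumes "\<And>u. ball_weight j u = c"
  shows "weighted_harmonic_mean G \<alpha> j = c"
proof -
  have "c > 0" using ball_weight_pos[of j] assms by metis
  then show ?thesis
    unfolding harmonic_mean_ball_weight assms
    by (simp add: sum_perron_squares flip: sum_divide_distrib)
qed

lemma arith_mean_sphere:
  assumes "graph_diam G \<ge> 1"
  shows "weighted_arith_mean G \<alpha> (graph_diam G) = real CARD('v)
    - (\<Sum>u\<in>UNIV. (\<alpha> $ u)\<^sup>2 * ball_weight (graph_diam G - 1) u) / real CARD('v)"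
  unfolding weighted_arith_mean_def sphere_weight[OF assms]
  by (simp add: right_diff_distrib sum_subtractf diff_divide_distrib sum_perron_squares
      flip: sum_distrib_right)

text \<open>
  Cauchy-Schwarz for the vectors \<open>\<alpha>\<^sub>u / y\<^sub>u\<close> and \<open>\<alpha>\<^sub>u y\<^sub>u\<close>, where \<open>y\<^sub>u\<^sup>2\<close> is the weight of the ball
  around \<open>u\<close>: the products of their entries are \<open>\<alpha>\<^sub>u\<^sup>2\<close>, which add up to \<open>n\<close>.
\<close>
lemma harmonic_le_arithmetic:
  "weighted_harmonic_mean G \<alpha> j \<le> (\<Sum>u\<in>UNIV. (\<alpha> $ u)\<^sup>2 * ball_weight j u) / real CARD('v)"
proof -
  let ?y = "\<lambda>u. norm (rho \<alpha> (nbhd G j u))"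
  have "(\<Sum>u\<in>UNIV. \<alpha> $ u / ?y u * (\<alpha> $ u * ?y u))\<^sup>2
    \<le> (\<Sum>u\<in>UNIV. (\<alpha> $ u / ?y u)\<^sup>2) * (\<Sum>u\<in>UNIV. (\<alpha> $ u * ?y u)\<^sup>2)"
    by (rule Cauchy_Schwarz_ineq_sum)
  moreover have "\<alpha> $ u / ?y u * (\<alpha> $ u * ?y u) = (\<alpha> $ u)\<^sup>2" for u
    using ball_norm_pos[of j u] by (simp add: power2_eq_square)
  ultimately have "(real CARD('v))\<^sup>2 \<le> (\<Sum>u\<in>UNIV. (\<alpha> $ u)\<^sup>2 / ball_weight j u)
      * (\<Sum>u\<in>UNIV. (\<alpha> $ u)\<^sup>2 * ball_weight j u)"
    by (simp only: sum_perron_squares power_divide power_mult_distrib ball_weight_def)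
  then show ?thesis
    using reciprocal_sum_pos[of j]
    by (simp add: harmonic_mean_ball_weight field_simps power2_eq_square)
qed

section \<open>The two bounds\<close>

lemma perron_projection_value:
  assumes "mat_poly p A = (\<chi> u v. \<alpha> $ u * \<alpha> $ v)"
  shows "poly p lam0 = real CARD('v)"
proof -
  fix u
  have "poly p lam0 * \<alpha> $ u = (mat_poly p A *v \<alpha>) $ u"
    by (simp add: mat_poly_eigenvector[OF perron_eigenvector])
  also have "\<dots> = \<alpha> $ u * (\<Sum>v\<in>UNIV. (\<alpha> $ v)\<^sup>2)"
    by (simp add: assms matrix_vector_mult_def sum_distrib_left power2_eq_square mult.assoc)
  finally show ?thesis
    using perron_pos[of u] by (simp add: sum_perron_squares)
qed

text \<open>
  Everything follows from the formula for the residual sum: \<open>q\<close> denotes the complementary head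
  \<open>P 0 + \<dots> + P (D - 1)\<close>, and both assertions about the tail translate into assertions about \<open>q\<close>.
\<close>
lemma predistance_tail_bound:
  assumes P: "predistance_polys A P" and D: "D = graph_diam G" "D \<ge> 1"
    and tail: "p_geD = (\<Sum>i=D..spec_d A. P i)"
    and H: "H = weighted_harmonic_mean G \<alpha> (D - 1)"
  shows "poly p_geD lam0 \<ge> real CARD('v) - H"
    and "poly p_geD lam0 = real CARD('v) - H \<longleftrightarrow> mat_poly p_geD A = weighted_dist_matrix G \<alpha> D"
proof -
  let ?n = "real CARD('v)" and ?j = "D - 1"
  define q where "q = (\<Sum>i<D. P i)"
  define S where "S = (\<Sum>u\<in>UNIV. (\<alpha> $ u)\<^sup>2 / ball_weight ?j u)"
  let ?total = "\<Sum>i\<le>spec_d A. P i"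
  note sym = transpose_adj_matrix
  have total: "mat_poly ?total A = (\<chi> u v. \<alpha> $ u * \<alpha> $ v)"
    by (rule mat_poly_sum_predistance[OF sym P perron perron_simple])
  have deg: "degree (P i) = i" if "i \<le> spec_d A" for i
    using P that by (simp add: predistance_polys_def)
  have "D \<le> degree ?total"
    unfolding D by (rule graph_diam_le_degree[OF perron_pos total])
  also have "degree ?total \<le> spec_d A"
    by (intro degree_sum_le) (auto simp: deg)
  finally have Dd: "D \<le> spec_d A" .
  have "{..spec_d A} = {..<D} \<union> {D..spec_d A}"
    using Dd by auto
  then have split: "?total = q + p_geD"
    unfolding q_def tail
    by (simp only:) (intro sum.union_disjoint, auto)
  have tail_value: "poly p_geD lam0 = ?n - poly q lam0"
    using perron_projection_value[OF total] by (simp add: split)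
  have tail_matrix: "mat_poly p_geD A = (\<chi> u v. \<alpha> $ u * \<alpha> $ v) - mat_poly q A"
    using total by (simp add: split mat_poly_add algebra_simps)
  have degq: "degree q \<le> ?j"
    unfolding q_def using Dd D by (intro degree_sum_le) (auto simp: deg)
  have qq: "mat_poly q A \<bullet> mat_poly q A = ?n * poly q lam0"
    unfolding q_def using Dd by (intro predistance_sum_frobenius sym P) auto
  have S: "S > 0"
    unfolding S_def by (rule reciprocal_sum_pos)
  have HS: "H = ?n / S"
    by (simp add: H S_def harmonic_mean_ball_weight)
  let ?res = "\<lambda>u. mat_poly q A $ u
      - (poly q lam0 * \<alpha> $ u / ball_weight ?j u) *\<^sub>R rho \<alpha> (nbhd G ?j u)"
  have res: "(\<Sum>u\<in>UNIV. (norm (?res u))\<^sup>2) = poly q lam0 * S * (H - poly q lam0)"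
    unfolding matrix_residual[OF degq] qq S_def[symmetric]
    using S by (simp add: HS field_simps power2_eq_square)
  have q_nonneg: "poly q lam0 \<ge> 0"
    using qq inner_ge_zero[of "mat_poly q A"] by (simp add: zero_le_mult_iff)
  have H_pos: "H > 0"
    using S by (simp add: HS)
  have le: "poly q lam0 \<le> H"
  proof (cases "poly q lam0 = 0")
    case False
    then have "poly q lam0 * S > 0"
      using q_nonneg S by simp
    moreover have "poly q lam0 * S * (H - poly q lam0) \<ge> 0"
      unfolding res[symmetric] by (intro sum_nonneg) simp
    ultimately show ?thesis
      by (simp add: zero_le_mult_iff)
  qed (use H_pos in simp)
  show "poly p_geD lam0 \<ge> ?n - H"
    using le tail_value by simp
  have dist_compl: "v \<in> nbhd G ?j u \<longleftrightarrow> graph_dist G u v \<noteq> D" for u v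
    using graph_dist_le_diam[of u v] D by (auto simp: in_nbhd_iff)
  have matrix_iff: "mat_poly p_geD A = weighted_dist_matrix G \<alpha> D
      \<longleftrightarrow> (\<forall>u. mat_poly q A $ u = \<alpha> $ u *\<^sub>R rho \<alpha> (nbhd G ?j u))"
    unfolding tail_matrix weighted_dist_matrix_def vec_eq_iff
    by (auto simp: rho_component dist_compl[unfolded One_nat_def])
  show "poly p_geD lam0 = ?n - H \<longleftrightarrow> mat_poly p_geD A = weighted_dist_matrix G \<alpha> D"
    unfolding matrix_iff
  proof
    assume "poly p_geD lam0 = ?n - H"
    then have qH: "poly q lam0 = H"
      by (simp add: tail_value)
    then have "?res u = 0" for u
      using res by (simp add: sum_nonneg_eq_0_iff)
    then have rows: "mat_poly q A $ u
        = (poly q lam0 * \<alpha> $ u / ball_weight ?j u) *\<^sub>R rho \<alpha> (nbhd G ?j u)" for u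
      by simp
    have "ball_weight ?j u = ball_weight ?j v" for u v
      by (rule ball_weight_constant[OF _ _ _ rows]) (use D qH H_pos in auto)
    then have "poly q lam0 = ball_weight ?j u" for u
      unfolding qH H by (rule harmonic_mean_constant)
    then show "\<forall>u. mat_poly q A $ u = \<alpha> $ u *\<^sub>R rho \<alpha> (nbhd G ?j u)"
      using rows ball_weight_pos[of ?j] by (metis less_irrefl nonzero_mult_div_cancel_left)
  next
    assume rows: "\<forall>u. mat_poly q A $ u = \<alpha> $ u *\<^sub>R rho \<alpha> (nbhd G ?j u)"
    \<comment> \<open>Row \<open>u\<close> of the equation \<open>q(A) \<alpha> = q(\<lambda>\<^sub>0) \<alpha>\<close> determines the weight of the ball.\<close>
    have "ball_weight ?j u = poly q lam0" for u
    proof -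
      have "poly q lam0 * \<alpha> $ u = mat_poly q A $ u \<bullet> \<alpha>"
        using mat_poly_eigenvector[OF perron_eigenvector, of q]
        by (simp flip: matrix_vector_mul_component)
      also have "rho \<alpha> (nbhd G ?j u) \<bullet> \<alpha> = ball_weight ?j u"
        unfolding ball_weight_def power2_norm_eq_inner inner_vec_def
        by (intro sum.cong) (auto simp: rho_component)
      then have "mat_poly q A $ u \<bullet> \<alpha> = \<alpha> $ u * ball_weight ?j u"
        by (simp add: rows)
      finally show ?thesis
        using perron_pos[of u] by simp
    qed
    then have "H = poly q lam0"
      unfolding H by (rule harmonic_mean_constant)
    then show "poly p_geD lam0 = ?n - H"
      by (simp add: tail_value)
  qed
qed

lemma harmonic_arithmetic_bound:
  assumes D: "D = graph_diam G" "D \<ge> 1"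
    and H: "H = weighted_harmonic_mean G \<alpha> (D - 1)"
    and \<delta>: "\<delta> = weighted_arith_mean G \<alpha> D"
  shows "real CARD('v) - H \<ge> \<delta>"
    and "(\<forall>u v. (norm (rho \<alpha> (sphere_at G D u)))\<^sup>2 = (norm (rho \<alpha> (sphere_at G D v)))\<^sup>2)
      \<Longrightarrow> real CARD('v) - H = \<delta>"
proof -
  have \<delta>_eq: "\<delta> = real CARD('v)
      - (\<Sum>u\<in>UNIV. (\<alpha> $ u)\<^sup>2 * ball_weight (D - 1) u) / real CARD('v)"
    using arith_mean_sphere D \<delta> by simp
  show "real CARD('v) - H \<ge> \<delta>"
    using harmonic_le_arithmetic[of "D - 1"] by (simp add: \<delta>_eq H)
  assume "\<forall>u v. (norm (rho \<alpha> (sphere_at G D u)))\<^sup>2 = (norm (rho \<alpha> (sphere_at G D v)))\<^sup>2"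
  then have "ball_weight (D - 1) u = ball_weight (D - 1) v" for u v
    using sphere_weight[of u] sphere_weight[of v] D
    by (smt (verit))
  then obtain c where c: "\<And>u. ball_weight (D - 1) u = c"
    by metis
  show "real CARD('v) - H = \<delta>"
    using harmonic_mean_constant[OF c]
    unfolding \<delta>_eq H c by (simp add: sum_perron_squares flip: sum_distrib_right)
qed

end

theorem theorem3p7:
  fixes G :: "('v::finite, 'e) pre_digraph"
    and A :: "real ^ 'v ^ 'v"
    and \<alpha> :: "real ^ 'v"
    and P :: "nat \<Rightarrow> real poly"
    and p_geD :: "real poly"
    and D d :: nat
    and n lam0 H \<delta> :: real
  assumes "graph G" and "verts G = UNIV" and "Digraph_Component.connected G"
    and "n = real CARD('v)"
    and "D = graph_diam G" and "D \<ge> 1"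
    and "A = adj_matrix G"
    and "lam0 = max_eigenvalue A"
    and "d = spec_d A"
    and "is_perron_vector A \<alpha>"
    and "predistance_polys A P"
    and "p_geD = (\<Sum>i=D..d. P i)"
    and "H = weighted_harmonic_mean G \<alpha> (D - 1)"
    and "\<delta> = weighted_arith_mean G \<alpha> D"
  shows "poly p_geD lam0 \<ge> n - H \<and> n - H \<ge> \<delta> \<and>
    (poly p_geD lam0 = n - H \<longleftrightarrow> mat_poly p_geD A = weighted_dist_matrix G \<alpha> D) \<and>
    ((\<forall>u v. (norm (rho \<alpha> (sphere_at G D u)))\<^sup>2 = (norm (rho \<alpha> (sphere_at G D v)))\<^sup>2)
        \<longrightarrow> n - H = \<delta>)"
proof -
  interpret perron_graph G \<alpha>
    using assms by (simp add: perron_graph_def perron_graph_axioms_def connected_full_graph_def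
        connected_full_graph_axioms_def)
  note tail = predistance_tail_bound[of P D p_geD H]
    and means = harmonic_arithmetic_bound[of D H \<delta>]
  show ?thesis
    using tail means assms by blast
qed

end
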